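(* Let $b'(n)$ be the total number of parts (counted with multiplicity) in all partitions in $\mathcal{P}_2(n)$ minus the total number of parts (counted with multiplicity) in all partitions in $\mathcal{POD}(n)$. Then for all $n\geq 1$, $$b'(n)=|\mathcal{POD}_1(n)|=|\mathcal{P}_{2,1}(n)|.$$
   Context: A partition of $n$ is a non-increasing finite sequence of positive integers (parts) with sum $n$. $\mathcal{P}_2(n)$ is the set of partitions of $n$ with no part congruent to $2 \bmod 4$. $\mathcal{POD}(n)$ is the set of partitions of $n$ in which no odd part is repeated (even parts are unrestricted). $\mathcal{POD}_1(n)$ is the set of partitions of $n$ in which exactly one odd part is repeated (i.e. exactly one odd integer occurs with multiplicity at least $2$), all other odd parts are distinct (occur at most once), and even parts are unrestricted. $\mathcal{P}_{2,1}(n)$ is the set of partitions of $n$ with exactly one part (possibly repeated) congruent to $2\bmod 4$, i.e. exactly one integer congruent to $2 \bmod 4$ occurs as a part value, with any multiplicity at least $1$, and all other parts are not congruent to $2\bmod 4$. *)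

theory Defs
  imports Main
begin

definition partitions :: "nat \<Rightarrow> nat list set" where
  "partitions n = {p. sorted_wrt (\<ge>) p \<and> (\<forall>x\<in>set p. 0 < x) \<and> sum_list p = n}"

definition P2 :: "nat \<Rightarrow> nat list set" where
  "P2 n = {p \<in> partitions n. \<forall>x\<in>set p. x mod 4 \<noteq> 2}"

definition POD :: "nat \<Rightarrow> nat list set" where
  "POD n = {p \<in> partitions n. \<forall>x. odd x \<longrightarrow> count_list p x \<le> 1}"

text \<open>The uniqueness part of the quantifier says that every other odd part occurs at most once.\<close>

definition POD1 :: "nat \<Rightarrow> nat list set" where
  "POD1 n = {p \<in> partitions n. \<exists>!x. odd x \<and> 2 \<le> count_list p x}"

text \<open>Uniqueness is that of the part as an integer; it may occur with any positive multiplicity.\<close>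

definition P21 :: "nat \<Rightarrow> nat list set" where
  "P21 n = {p \<in> partitions n. \<exists>!x. x \<in> set p \<and> x mod 4 = 2}"

definition num_parts :: "nat list set \<Rightarrow> nat" where
  "num_parts A = (\<Sum>p\<in>A. length p)"

definition b' :: "nat \<Rightarrow> int" where
  "b' n = int (num_parts (P2 n)) - int (num_parts (POD n))"

text \<open>The sums and cardinalities taken over these sets range over finite sets.\<close>

lemma finite_partitions: "finite (partitions n)"
proof (rule finite_subset)
  have len: "length p \<le> sum_list p" if "\<forall>x\<in>set p. 0 < x" for p :: "nat list"
    using that by (induction p) auto
  show "partitions n \<subseteq> {p. set p \<subseteq> {..n} \<and> length p \<le> n}"
    using len by (auto simp: partitions_def intro: member_le_sum_list)
  show "finite {p. set p \<subseteq> {..n} \<and> length p \<le> n}"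
    by (rule finite_lists_length_le) simp
qed

lemma finite_partition_classes:
  "finite (P2 n)" "finite (POD n)" "finite (POD1 n)" "finite (P21 n)"
  by (simp_all add: P2_def POD_def POD1_def P21_def finite_partitions)

end

theory Submission
  imports Defs "HOL-Library.Multiset"
begin

text \<open>
  Everything rests on one involution of the set of all partitions of \<open>n\<close>. For odd \<open>i\<close>, let a
  partition contain the part \<open>i\<close> with multiplicity \<open>a\<close> and the part \<open>2 * i\<close> with multiplicity
  \<open>b\<close>. Write \<open>a = 2 * c + e\<close> with \<open>e \<le> 1\<close>: the pairs of equal parts \<open>i\<close> contribute \<open>2 * i * c\<close>
  to the sum and the parts \<open>2 * i\<close> contribute \<open>2 * i * b\<close>, so the roles of \<open>b\<close> and \<open>c\<close> can be
  exchanged without changing the sum. Doing this for all odd \<open>i\<close> at once (\<open>exchange\<close> below)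
  turns ``the odd part \<open>i\<close> is repeated'' into ``the part \<open>2 * i\<close> occurs'' and vice versa. Hence
  it matches \<open>POD\<close> with \<open>P2\<close> and \<open>POD1\<close> with \<open>P21\<close> (lemma \<open>bij_betw_exchange\<close>), which gives the
  second equality.

  For a partition in \<open>P2\<close> the exchange merges every pair of equal odd parts into one part, so
  it loses one part per pair. The difference \<open>b' n\<close> therefore counts pairs of equal odd parts
  in the partitions in \<open>P2\<close>, that is, the triples of a partition in \<open>P2\<close>, an odd \<open>i\<close>
  and a number \<open>j \<ge> 1\<close> such that \<open>2 * j\<close> copies of \<open>i\<close> are present. Merging exactly these copies
  into \<open>j\<close> copies of \<open>2 * i\<close> gives a partition in \<open>P21\<close>; since \<open>2 * i\<close> is then its only
  part congruent to 2 modulo 4, the triple can be recovered from it (lemma \<open>card_mP21\<close>).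

  The operations act on multiplicities, so partitions are treated as multisets of positive
  integers.
\<close>

section \<open>Partitions as multisets\<close>

definition mpartitions :: "nat \<Rightarrow> nat multiset set" where
  "mpartitions n = {M. 0 \<notin># M \<and> sum_mset M = n}"

lemma bij_betw_mset_partitions:
  "bij_betw mset {p \<in> partitions n. Q (mset p)} {M \<in> mpartitions n. Q M}"
proof (rule bij_betwI')
  fix p q assume "p \<in> {p \<in> partitions n. Q (mset p)}" "q \<in> {p \<in> partitions n. Q (mset p)}"
  then have s: "sorted (rev p)" "sorted (rev q)"
    by (auto simp: partitions_def sorted_wrt_rev)
  show "(mset p = mset q) = (p = q)"
  proof
    assume "mset p = mset q"
    then have "rev p = rev q"
      using s by (metis mset_rev properties_for_sort)
    then show "p = q" by simp
  qed simp
next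
  fix p assume "p \<in> {p \<in> partitions n. Q (mset p)}"
  then show "mset p \<in> {M \<in> mpartitions n. Q M}"
    by (auto simp: partitions_def mpartitions_def sum_mset_sum_list)
next
  fix M assume M: "M \<in> {M \<in> mpartitions n. Q M}"
  let ?p = "rev (sorted_list_of_multiset M)"
  have "sum_list ?p = n"
    using M by (simp flip: sum_mset_sum_list add: mpartitions_def)
  moreover have "sorted_wrt (\<ge>) ?p"
    by (simp add: sorted_wrt_rev)
  moreover have "\<forall>x\<in>set ?p. 0 < x"
    using M by (auto simp: mpartitions_def intro: gr0I)
  ultimately have "?p \<in> {p \<in> partitions n. Q (mset p)}"
    using M by (simp add: partitions_def)
  then show "\<exists>p\<in>{p \<in> partitions n. Q (mset p)}. M = mset p"
    by (intro bexI[of _ ?p]) simp_all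
qed

lemma finite_mpartitions: "finite (mpartitions n)"
  using bij_betw_finite[OF bij_betw_mset_partitions[of n "\<lambda>_. True"]] finite_partitions
  by simp

definition mP2 :: "nat \<Rightarrow> nat multiset set" where
  "mP2 n = {M \<in> mpartitions n. \<forall>x. x mod 4 = 2 \<longrightarrow> x \<notin># M}"

definition mPOD :: "nat \<Rightarrow> nat multiset set" where
  "mPOD n = {M \<in> mpartitions n. \<forall>x. odd x \<longrightarrow> count M x \<le> 1}"

definition mPOD1 :: "nat \<Rightarrow> nat multiset set" where
  "mPOD1 n = {M \<in> mpartitions n. \<exists>!x. odd x \<and> 2 \<le> count M x}"

definition mP21 :: "nat \<Rightarrow> nat multiset set" where
  "mP21 n = {M \<in> mpartitions n. \<exists>!x. x \<in># M \<and> x mod 4 = 2}"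

lemma bij_betw_mset_classes:
  "bij_betw mset (P2 n) (mP2 n)" "bij_betw mset (POD n) (mPOD n)"
  "bij_betw mset (POD1 n) (mPOD1 n)" "bij_betw mset (P21 n) (mP21 n)"
proof -
  have "P2 n = {p \<in> partitions n. \<forall>x. x mod 4 = 2 \<longrightarrow> x \<notin># mset p}"
    by (auto simp: P2_def)
  then show "bij_betw mset (P2 n) (mP2 n)"
    using bij_betw_mset_partitions[of n "\<lambda>M. \<forall>x. x mod 4 = 2 \<longrightarrow> x \<notin># M"]
    by (simp only: mP2_def)
  show "bij_betw mset (POD n) (mPOD n)"
    using bij_betw_mset_partitions[of n "\<lambda>M. \<forall>x. odd x \<longrightarrow> count M x \<le> 1"]
    by (simp add: POD_def mPOD_def count_mset)
  show "bij_betw mset (POD1 n) (mPOD1 n)"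
    using bij_betw_mset_partitions[of n "\<lambda>M. \<exists>!x. odd x \<and> 2 \<le> count M x"]
    by (simp add: POD1_def mPOD1_def count_mset)
  show "bij_betw mset (P21 n) (mP21 n)"
    using bij_betw_mset_partitions[of n "\<lambda>M. \<exists>!x. x \<in># M \<and> x mod 4 = 2"]
    by (simp add: P21_def mP21_def)
qed

lemma num_parts_eq_sum_size:
  assumes "bij_betw mset A B"
  shows "num_parts A = (\<Sum>M\<in>B. size M)"
  using sum.reindex_bij_betw[OF assms, of size] by (simp add: num_parts_def)


section \<open>Exchanging pairs of equal odd parts with their doubles\<close>

text \<open>After matching up equal elements as far as possible, \<open>pairs M\<close> holds one representative of
  every matched pair and \<open>unpaired M\<close> the elements left over.\<close>

definition pairs :: "'a multiset \<Rightarrow> 'a multiset" where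
  "pairs M = Abs_multiset (\<lambda>x. count M x div 2)"

definition unpaired :: "'a multiset \<Rightarrow> 'a multiset" where
  "unpaired M = Abs_multiset (\<lambda>x. count M x mod 2)"

lemma count_pairs [simp]: "count (pairs M) x = count M x div 2"
proof -
  have "finite {x. 0 < count M x div 2}"
    by (rule finite_subset[of _ "set_mset M"]) (auto simp flip: count_greater_zero_iff)
  then show ?thesis by (simp add: pairs_def count_Abs_multiset)
qed

lemma count_unpaired [simp]: "count (unpaired M) x = count M x mod 2"
proof -
  have "finite {x. 0 < count M x mod 2}"
    by (rule finite_subset[of _ "set_mset M"]) (auto simp flip: count_greater_zero_iff intro: gr0I)
  then show ?thesis by (simp add: unpaired_def count_Abs_multiset)
qed

lemma pairs_unpaired: "M = unpaired M + pairs M + pairs M"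
proof (rule multiset_eqI)
  fix x
  show "count M x = count (unpaired M + pairs M + pairs M) x"
    by simp presburger
qed

text \<open>The sum of \<open>M\<close> and the number of its parts are additive in the four summands, so both are
  easy to follow; on multiplicities, the exchange described at the beginning becomes visible in
  \<open>count_exchange_odd\<close> and \<open>count_exchange_double\<close>.\<close>

definition exchange :: "nat multiset \<Rightarrow> nat multiset" where
  "exchange M =
     (let H = image_mset (\<lambda>x. x div 2) {#x \<in># M. x mod 4 = 2#}
      in {#x \<in># M. x mod 4 = 0#} + unpaired {#x \<in># M. odd x#} + (H + H)
         + image_mset (\<lambda>x. 2 * x) (pairs {#x \<in># M. odd x#}))"

lemma partition_mod_4:
  fixes M :: "nat multiset"
  shows "M = {#x \<in># M. x mod 4 = 0#} + {#x \<in># M. odd x#} + {#x \<in># M. x mod 4 = 2#}"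
proof (rule multiset_eqI)
  fix x :: nat
  have "x mod 4 = 0 \<and> even x \<or> odd x \<and> x mod 4 \<noteq> 0 \<and> x mod 4 \<noteq> 2 \<or> x mod 4 = 2 \<and> even x"
    by presburger
  then show "count M x =
      count ({#x \<in># M. x mod 4 = 0#} + {#x \<in># M. odd x#} + {#x \<in># M. x mod 4 = 2#}) x"
    by auto
qed

lemma sum_mset_exchange: "sum_mset (exchange M) = sum_mset M"
proof -
  define A where "A = {#x \<in># M. x mod 4 = 0#}"
  define B where "B = {#x \<in># M. odd x#}"
  define C where "C = {#x \<in># M. x mod 4 = 2#}"
  have "2 * sum_mset (image_mset (\<lambda>x. x div 2) C) = sum_mset (image_mset (\<lambda>x. 2 * (x div 2)) C)"
    by (simp add: sum_mset_distrib_left)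
  also have "image_mset (\<lambda>x. 2 * (x div 2)) C = image_mset (\<lambda>x. x) C"
    by (intro image_mset_cong) (auto simp: C_def, presburger)
  finally have C: "2 * sum_mset (image_mset (\<lambda>x. x div 2) C) = sum_mset C"
    by simp
  have D: "sum_mset (image_mset (\<lambda>x. 2 * x) (pairs B)) = 2 * sum_mset (pairs B)"
    using sum_mset_distrib_left[of 2 "\<lambda>x. x" "pairs B"] by simp
  have B: "sum_mset B = sum_mset (unpaired B) + 2 * sum_mset (pairs B)"
    using arg_cong[OF pairs_unpaired[of B], of sum_mset] by simp
  have "sum_mset M = sum_mset A + sum_mset B + sum_mset C"
    unfolding A_def B_def C_def using arg_cong[OF partition_mod_4[of M], of sum_mset] by simp
  then show ?thesis
    using B C D by (simp add: exchange_def Let_def flip: A_def B_def C_def)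
qed

lemma count_image_double_odd [simp]:
  "odd x \<Longrightarrow> count (image_mset (\<lambda>x. 2 * x) M) x = 0" for x :: nat
  by (auto simp: count_eq_zero_iff)

lemma count_image_double [simp]:
  "count (image_mset (\<lambda>x. 2 * x) M) (2 * x) = count M x" for x :: nat
  using count_image_mset[of "\<lambda>x. 2 * x" M "2 * x"]
  by (cases "x \<in># M") (auto simp: vimage_def not_in_iff)

lemma count_image_half:
  fixes M :: "nat multiset"
  assumes "\<forall>x\<in>#M. even x"
  shows "count (image_mset (\<lambda>x. x div 2) M) x = count M (2 * x)"
proof -
  have "image_mset (\<lambda>x. 2 * x) (image_mset (\<lambda>x. x div 2) M) = image_mset (\<lambda>x. x) M"
    unfolding multiset.map_comp comp_def using assms by (intro image_mset_cong) auto
  then show ?thesis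
    by (metis count_image_double multiset.map_ident)
qed

lemma count_exchange_odd:
  assumes "odd x"
  shows "count (exchange M) x = count M x mod 2 + 2 * count M (2 * x)"
proof -
  have "x mod 4 \<noteq> 0" "(2 * x) mod 4 = 2"
    using assms by presburger+
  moreover have "even y" if "y mod 4 = 2" for y :: nat
    using that by presburger
  ultimately show ?thesis
    using assms by (simp add: exchange_def Let_def count_image_half)
qed

lemma count_exchange_double:
  assumes "odd x"
  shows "count (exchange M) (2 * x) = count M x div 2"
proof -
  have "(2 * x) mod 4 = 2" "(2 * (2 * x)) mod 4 \<noteq> 2"
    using assms by presburger+
  moreover have "even y" if "y mod 4 = 2" for y :: nat
    using that by presburger
  ultimately show ?thesis
    using assms by (simp add: exchange_def Let_def count_image_half)
qed

lemma count_exchange_div_4: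
  assumes "x mod 4 = 0"
  shows "count (exchange M) x = count M x"
proof -
  obtain y where y: "x = 2 * (2 * y)"
    using assms by (metis mod_0_imp_dvd dvdE mult.assoc numeral_Bit0_eq_double)
  have "even y" if "y mod 4 = 2" for y :: nat
    using that by presburger
  moreover have "(2 * x) mod 4 \<noteq> 2" "even x"
    using assms by presburger+
  moreover have "count (image_mset (\<lambda>x. 2 * x) (pairs {#x \<in># M. odd x#})) x = 0"
    unfolding y count_image_double by simp
  ultimately show ?thesis
    using assms by (simp add: exchange_def Let_def count_image_half)
qed

lemma mod_4_cases:
  fixes x :: nat
  obtains "odd x" | y where "x = 2 * y" "odd y" | "x mod 4 = 0"
proof -
  have "odd x \<or> (x = 2 * (x div 2) \<and> odd (x div 2)) \<or> x mod 4 = 0"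
    by presburger
  then show ?thesis using that by metis
qed

text \<open>For odd \<open>x\<close> the map acts on the multiplicities of \<open>x\<close> and \<open>2 * x\<close> by
  \<open>(2 * c + e, b) \<mapsto> (2 * b + e, c)\<close>, which is its own inverse.\<close>

lemma exchange_exchange [simp]: "exchange (exchange M) = M"
proof (rule multiset_eqI)
  fix x :: nat
  show "count (exchange (exchange M)) x = count M x"
    by (cases x rule: mod_4_cases)
      (simp_all add: count_exchange_odd count_exchange_double count_exchange_div_4)
qed

lemma exchange_in_mpartitions_iff [simp]:
  "exchange M \<in> mpartitions n \<longleftrightarrow> M \<in> mpartitions n"
  using count_exchange_div_4[of 0 M]
  by (simp add: mpartitions_def sum_mset_exchange flip: count_eq_zero_iff)

text \<open>This equivalence is why the exchange matches the conditions on repeated odd parts with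
  those on parts congruent to 2 modulo 4.\<close>

lemma exchange_contains_double_iff:
  assumes "odd x"
  shows "2 * x \<in># exchange M \<longleftrightarrow> 2 \<le> count M x"
proof -
  have "2 * x \<in># exchange M \<longleftrightarrow> 0 < count M x div 2"
    using count_exchange_double[OF assms, of M] by (metis count_greater_zero_iff)
  then show ?thesis by (simp add: div_greater_zero_iff)
qed

lemma mod_4_eq_2_iff: "x mod 4 = 2 \<longleftrightarrow> (\<exists>y. x = 2 * y \<and> odd y)" for x :: nat
proof
  assume "x mod 4 = 2"
  then have "x = 2 * (x div 2) \<and> odd (x div 2)" by presburger
  then show "\<exists>y. x = 2 * y \<and> odd y" ..
qed presburger

lemma exchange_in_mP2_iff: "exchange M \<in> mP2 n \<longleftrightarrow> M \<in> mPOD n"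
proof -
  have "(\<forall>x. x mod 4 = 2 \<longrightarrow> x \<notin># exchange M) \<longleftrightarrow> (\<forall>y. odd y \<longrightarrow> 2 * y \<notin># exchange M)"
    by (auto simp: mod_4_eq_2_iff)
  also have "\<dots> \<longleftrightarrow> (\<forall>y. odd y \<longrightarrow> count M y \<le> 1)"
    by (auto simp: exchange_contains_double_iff not_le)
  finally show ?thesis by (simp add: mP2_def mPOD_def)
qed

lemma exchange_in_mP21_iff: "exchange M \<in> mP21 n \<longleftrightarrow> M \<in> mPOD1 n"
proof -
  have "(\<exists>!x. x \<in># exchange M \<and> x mod 4 = 2) \<longleftrightarrow> (\<exists>!y. odd y \<and> 2 * y \<in># exchange M)"
  proof
    assume "\<exists>!x. x \<in># exchange M \<and> x mod 4 = 2"
    then obtain x where x: "x \<in># exchange M" "x mod 4 = 2"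
      and uniq: "\<And>z. z \<in># exchange M \<Longrightarrow> z mod 4 = 2 \<Longrightarrow> z = x"
      by blast
    obtain y where "x = 2 * y" "odd y"
      using x(2) by (auto simp: mod_4_eq_2_iff)
    moreover have "z = y" if "odd z" "2 * z \<in># exchange M" for z
      using uniq[OF that(2)] that(1) \<open>x = 2 * y\<close> by (simp add: mod_4_eq_2_iff)
    ultimately show "\<exists>!y. odd y \<and> 2 * y \<in># exchange M"
      using x(1) by blast
  next
    assume "\<exists>!y. odd y \<and> 2 * y \<in># exchange M"
    then show "\<exists>!x. x \<in># exchange M \<and> x mod 4 = 2"
      unfolding mod_4_eq_2_iff by blast
  qed
  also have "\<dots> \<longleftrightarrow> (\<exists>!y. odd y \<and> 2 \<le> count M y)"
    by (simp add: exchange_contains_double_iff cong: conj_cong)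
  finally show ?thesis by (simp add: mP21_def mPOD1_def)
qed

lemma bij_betw_exchange:
  "bij_betw exchange (mP2 n) (mPOD n)" "bij_betw exchange (mPOD1 n) (mP21 n)"
proof -
  show "bij_betw exchange (mP2 n) (mPOD n)"
    by (rule bij_betw_byWitness[of _ exchange]) (auto simp flip: exchange_in_mP2_iff)
  show "bij_betw exchange (mPOD1 n) (mP21 n)"
    by (rule bij_betw_byWitness[of _ exchange]) (auto simp flip: exchange_in_mP21_iff)
qed

text \<open>Without parts congruent to 2 modulo 4, the exchange only merges: each pair of equal
  odd parts becomes a single part.\<close>

lemma size_exchange_mP2:
  assumes "M \<in> mP2 n"
  shows "size M = size (exchange M) + size (pairs {#x \<in># M. odd x#})"
proof -
  define B where "B = {#x \<in># M. odd x#}"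
  have C: "{#x \<in># M. x mod 4 = 2#} = {#}"
    using assms by (auto simp: mP2_def multiset_eq_iff not_in_iff)
  have "size M = size {#x \<in># M. x mod 4 = 0#} + size B"
    using arg_cong[OF partition_mod_4[of M], of size] C by (simp add: B_def)
  moreover have "size B = size (unpaired B) + 2 * size (pairs B)"
    using arg_cong[OF pairs_unpaired[of B], of size] by simp
  ultimately show ?thesis
    using C by (simp add: exchange_def Let_def flip: B_def)
qed


section \<open>Merging copies of a single odd part\<close>

definition merge_choices :: "nat multiset \<Rightarrow> (nat \<times> nat) set" where
  "merge_choices M = {(i, j). odd i \<and> 1 \<le> j \<and> 2 * j \<le> count M i}"

definition merge :: "nat multiset \<times> nat \<times> nat \<Rightarrow> nat multiset" where
  "merge = (\<lambda>(M, i, j). M - replicate_mset (2 * j) i + replicate_mset j (2 * i))"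

text \<open>A pair of equal odd parts \<open>i\<close> corresponds to its rank \<open>j\<close> among the pairs formed by \<open>i\<close>.\<close>

lemma card_merge_choices:
  "finite (merge_choices M)" "card (merge_choices M) = size (pairs {#x \<in># M. odd x#})"
proof -
  let ?B = "{#x \<in># M. odd x#}"
  let ?S = "set_mset (pairs ?B)"
  have S: "i \<in> ?S \<longleftrightarrow> odd i \<and> 1 \<le> count M i div 2" for i
    by (simp add: Suc_le_eq flip: count_greater_zero_iff)
  have "odd i \<and> 1 \<le> j \<and> 2 * j \<le> count M i \<longleftrightarrow> i \<in> ?S \<and> j \<in> {1..count (pairs ?B) i}" for i j
  proof -
    have "1 \<le> j \<and> 2 * j \<le> c \<longleftrightarrow> 1 \<le> c div 2 \<and> 1 \<le> j \<and> j \<le> c div 2" for c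
      by presburger
    from this[of "count M i"] show ?thesis
      unfolding S atLeastAtMost_iff count_pairs count_filter_mset by auto
  qed
  then have eq: "merge_choices M = Sigma ?S (\<lambda>i. {1..count (pairs ?B) i})"
    unfolding merge_choices_def by blast
  show "finite (merge_choices M)"
    unfolding eq by (intro finite_SigmaI) auto
  show "card (merge_choices M) = size (pairs ?B)"
    unfolding eq by (subst card_SigmaI) (auto simp: size_multiset_overloaded_eq)
qed

text \<open>Splitting the parts \<open>2 * i\<close> again undoes the merging, so the choice \<open>(i, j)\<close> and the merged
  partition together determine \<open>M\<close>.\<close>

lemma merge_unmerge:
  assumes "(i, j) \<in> merge_choices M"
  shows "M = merge (M, i, j) - replicate_mset j (2 * i) + replicate_mset (2 * j) i"
proof (rule multiset_eqI)
  fix x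
  have "2 * j \<le> count M i" "i \<noteq> 2 * i"
    using assms by (auto simp: merge_choices_def intro: gr0I)
  then show "count M x =
      count (merge (M, i, j) - replicate_mset j (2 * i) + replicate_mset (2 * j) i) x"
    by (auto simp: merge_def)
qed

lemma count_merge:
  assumes "M \<in> mP2 n" "(i, j) \<in> merge_choices M" "x mod 4 = 2"
  shows "count (merge (M, i, j)) x = (if x = 2 * i then j else 0)"
proof -
  have "count M x = 0"
    using assms by (auto simp: mP2_def count_eq_zero_iff)
  then show ?thesis by (simp add: merge_def)
qed

lemma merge_in_mP21:
  assumes M: "M \<in> mP2 n" and ij: "(i, j) \<in> merge_choices M"
  shows "merge (M, i, j) \<in> mP21 n"
proof -
  have i: "odd i" "(2 * i) mod 4 = 2" "1 \<le> j" and le: "2 * j \<le> count M i"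
    using ij by (auto simp: merge_choices_def) presburger
  have "replicate_mset (2 * j) i \<subseteq># M"
    using le by (simp add: count_le_replicate_mset_subset_eq)
  then obtain R where R: "M = R + replicate_mset (2 * j) i"
    by (metis subset_mset.diff_add)
  have "merge (M, i, j) = R + replicate_mset j (2 * i)"
    by (simp add: merge_def R)
  then have "merge (M, i, j) \<in> mpartitions n"
    using M i by (auto simp: mP2_def mpartitions_def R split: if_splits)
  moreover have "\<exists>!x. x \<in># merge (M, i, j) \<and> x mod 4 = 2"
  proof (rule ex1I[of _ "2 * i"])
    show "2 * i \<in># merge (M, i, j) \<and> (2 * i) mod 4 = 2"
      using i by (simp add: merge_def)
  next
    fix x assume "x \<in># merge (M, i, j) \<and> x mod 4 = 2"
    then show "x = 2 * i"
      using count_merge[OF M ij, of x] by (auto simp flip: count_greater_zero_iff split: if_splits)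
  qed
  ultimately show ?thesis by (simp add: mP21_def)
qed

lemma inj_on_merge: "inj_on merge (Sigma (mP2 n) merge_choices)"
proof -
  have "M = M' \<and> i = i' \<and> j = j'"
    if M: "M \<in> mP2 n" and ij: "(i, j) \<in> merge_choices M"
      and M': "M' \<in> mP2 n" and ij': "(i', j') \<in> merge_choices M'"
      and eq: "merge (M, i, j) = merge (M', i', j')"
    for M i j M' i' j'
  proof -
    have *: "(2 * i) mod 4 = 2" "1 \<le> j"
      using ij by (auto simp: merge_choices_def) presburger
    \<comment> \<open>The part \<open>2 * i\<close> and its multiplicity are visible in the merged partition.\<close>
    have "j = (if 2 * i = 2 * i' then j' else 0)"
      using count_merge[OF M ij *(1)] count_merge[OF M' ij' *(1)] eq by simp
    then have "i = i'" "j = j'"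
      using * by (auto split: if_splits)
    then show ?thesis
      using merge_unmerge[OF ij] merge_unmerge[OF ij'] eq by simp
  qed
  then show ?thesis
    by (auto simp: inj_on_def)
qed

text \<open>A preimage is obtained by splitting every copy of the only part congruent to 2 modulo 4
  into two odd halves.\<close>

lemma merge_surj:
  assumes "N \<in> mP21 n"
  shows "N \<in> merge ` Sigma (mP2 n) merge_choices"
proof -
  obtain x where x: "x \<in># N" "x mod 4 = 2" and uniq: "\<And>y. y \<in># N \<Longrightarrow> y mod 4 = 2 \<Longrightarrow> y = x"
    using assms unfolding mP21_def by blast
  obtain i where i: "x = 2 * i" "odd i"
    using x by (auto simp: mod_4_eq_2_iff)
  define j where "j = count N x"
  have "replicate_mset j x \<subseteq># N"
    by (simp add: j_def flip: count_le_replicate_mset_subset_eq)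
  then obtain R where R: "N = R + replicate_mset j x"
    by (metis subset_mset.diff_add)
  let ?M = "R + replicate_mset (2 * j) i"
  have "1 \<le> j" using x by (simp add: j_def Suc_le_eq)
  then have ch: "(i, j) \<in> merge_choices ?M"
    using i by (simp add: merge_choices_def)
  have "x \<notin># R"
    using R j_def by (metis add_diff_cancel_right' count_diff count_replicate_mset diff_self_eq_0 not_in_iff)
  moreover have "y \<in># N" if "y \<in># R" for y
    using that by (simp add: R)
  ultimately have "y \<notin># R" if "y mod 4 = 2" for y
    using uniq[of y] that by blast
  moreover have "i mod 4 \<noteq> 2"
    using i by presburger
  moreover have "N \<in> mpartitions n"
    using assms by (simp add: mP21_def)
  then have "?M \<in> mpartitions n"
    using i by (auto simp: mpartitions_def R split: if_splits)
  ultimately have "?M \<in> mP2 n"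
    by (auto simp: mP2_def split: if_splits)
  moreover have "merge (?M, i, j) = N"
    by (simp add: merge_def R i)
  ultimately show ?thesis
    using ch by (intro image_eqI[of _ _ "(?M, i, j)"]) auto
qed

lemma card_mP21: "card (mP21 n) = (\<Sum>M\<in>mP2 n. size (pairs {#x \<in># M. odd x#}))"
proof -
  have "merge ` Sigma (mP2 n) merge_choices = mP21 n"
    using merge_in_mP21 merge_surj by auto
  then have "card (mP21 n) = card (Sigma (mP2 n) merge_choices)"
    using card_image[OF inj_on_merge] by metis
  moreover have "finite (mP2 n)"
    by (simp add: mP2_def finite_mpartitions)
  ultimately show ?thesis
    by (simp add: card_SigmaI card_merge_choices)
qed


section \<open>The difference of the numbers of parts\<close>

theorem theorem9p4:
  fixes n :: nat
  assumes "n \<ge> 1"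
  shows "b' n = int (card (POD1 n)) \<and> card (POD1 n) = card (P21 n)"
proof -
  have "num_parts (P2 n) = (\<Sum>M\<in>mP2 n. size M)"
    by (rule num_parts_eq_sum_size[OF bij_betw_mset_classes(1)])
  also have "\<dots> = (\<Sum>M\<in>mP2 n. size (exchange M)) + (\<Sum>M\<in>mP2 n. size (pairs {#x \<in># M. odd x#}))"
    unfolding sum.distrib[symmetric] by (rule sum.cong[OF refl]) (rule size_exchange_mP2)
  also have "(\<Sum>M\<in>mP2 n. size (exchange M)) = (\<Sum>M\<in>mPOD n. size M)"
    by (rule sum.reindex_bij_betw[OF bij_betw_exchange(1)])
  also have "\<dots> = num_parts (POD n)"
    by (rule num_parts_eq_sum_size[OF bij_betw_mset_classes(2), symmetric])
  finally have "b' n = int (card (mP21 n))"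
    by (simp add: b'_def card_mP21)
  moreover have "card (P21 n) = card (mP21 n)" "card (POD1 n) = card (mPOD1 n)"
    by (rule bij_betw_same_card[OF bij_betw_mset_classes(4)])
      (rule bij_betw_same_card[OF bij_betw_mset_classes(3)])
  moreover have "card (mPOD1 n) = card (mP21 n)"
    by (rule bij_betw_same_card[OF bij_betw_exchange(2)])
  ultimately show ?thesis by simp
qed

end
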